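(* Let $0<c<1$, let $f\in X_c^*$ and let $(h_k)\subset X_c^*$ be weakly null. If $L:=\limsup_k\|h_k\|_{X_c^*}$, then $$\limsup_k\|f+h_k\|_{X_c^*}\ge\bigl(\|f\|_{X_c^*}^2+L^2\bigr)^{1/2}.$$ In particular, $X_c^*$ has the Opial property.
   Context: All Banach spaces are real; $E^*$ is the dual of $E$ with the dual norm. A Banach space $E$ has the Opial property if for every $x\in E$ with $x\neq0$ and every weakly null sequence $(x_n)$ in $E$, $\limsup_n\|x_n\|<\limsup_n\|x+x_n\|$. Definition of $X_c$. A norm $N$ on $\mathbb R^2$ is absolute if $N(s,t)=N(|s|,|t|)$ and normalized if $N(1,0)=N(0,1)=1$. Given a sequence $(N_n)_{n\ge1}$ of absolute normalized norms on $\mathbb R^2$, define norms $M_n$ on $\mathbb R^{n+1}$ by $M_0(x_0)=|x_0|$ and $M_n(x_0,\dots,x_n)=N_n(M_{n-1}(x_0,\dots,x_{n-1}),|x_n|)$ for $n\ge1$. For a finitely supported real sequence $x=(x_j)_{j\ge0}\in c_{00}$ put $\|x\|=M_n(x_0,\dots,x_n)$ for any $n$ with $x_j=0$ for all $j>n$ (this is independent of $n$). $A(N_n)$ denotes the completion of $c_{00}$ in this norm, with canonical basis $(e_j)_{j\ge0}$. For $0<c<1$ and $n\ge1$ let $$N_{n,c}(s,t)=\left[(1-c^{2n})|t|^{2n}+(s^2+c^2t^2)^n\right]^{1/(2n)},$$ which is an absolute normalized norm on $\mathbb R^2$, and set $X_c:=A(N_{n,c})$. *)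

theory Defs
  imports "HOL-Analysis.Analysis"
begin

definition weakly_null :: "(nat \<Rightarrow> 'a::real_normed_vector) \<Rightarrow> bool" where
  "weakly_null x \<longleftrightarrow>
     (\<forall>\<phi> :: 'a \<Rightarrow>\<^sub>L real. (\<lambda>n. blinfun_apply \<phi> (x n)) \<longlonglongrightarrow> 0)"

definition opial_property :: "'a::banach itself \<Rightarrow> bool" where
  "opial_property (_ :: 'a itself) \<longleftrightarrow>
     (\<forall>(x :: 'a) xs. x \<noteq> 0 \<longrightarrow> weakly_null xs \<longrightarrow>
        limsup (\<lambda>n. ereal (norm (xs n))) < limsup (\<lambda>n. ereal (norm (x + xs n))))"

definition absolute_normalized_norm :: "(real \<Rightarrow> real \<Rightarrow> real) \<Rightarrow> bool" where
  "absolute_normalized_norm N \<longleftrightarrow>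
     (\<forall>s t. N s t = 0 \<longrightarrow> s = 0 \<and> t = 0) \<and>
     (\<forall>a s t. N (a * s) (a * t) = \<bar>a\<bar> * N s t) \<and>
     (\<forall>s t s' t'. N (s + s') (t + t') \<le> N s t + N s' t') \<and>
     (\<forall>s t. N s t = N \<bar>s\<bar> \<bar>t\<bar>) \<and>
     N 1 0 = 1 \<and> N 0 1 = 1"

text \<open>A sequence of norms \<open>(N\<^sub>n)\<close>, \<open>n \<ge> 1\<close>, is a function on all of \<open>nat\<close> whose
  value at \<open>0\<close> is never used. \<open>M_norm N n x\<close> depends on \<open>x 0, \<dots>, x n\<close> only.\<close>

primrec M_norm :: "(nat \<Rightarrow> real \<Rightarrow> real \<Rightarrow> real) \<Rightarrow> nat \<Rightarrow> (nat \<Rightarrow> real) \<Rightarrow> real" where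
  "M_norm N 0 x = \<bar>x 0\<bar>"
| "M_norm N (Suc n) x = N (Suc n) (M_norm N n x) \<bar>x (Suc n)\<bar>"

definition c00 :: "(nat \<Rightarrow> real) set" where
  "c00 = {x. finite {j. x j \<noteq> 0}}"

definition c00_norm :: "(nat \<Rightarrow> real \<Rightarrow> real \<Rightarrow> real) \<Rightarrow> (nat \<Rightarrow> real) \<Rightarrow> real" where
  "c00_norm N x = M_norm N (LEAST n. \<forall>j>n. x j = 0) x"

text \<open>The least admissible index is an arbitrary choice, see \<open>c00_norm_eq\<close>.\<close>

lemma absolute_normalized_norm_nonneg:
  assumes "absolute_normalized_norm N"
  shows "N s t \<ge> 0"
proof -
  have "N (s + - s) (t + - t) \<le> N s t + N (- s) (- t)"
    using assms unfolding absolute_normalized_norm_def by blast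
  moreover have "N (0 * s) (0 * t) = \<bar>0\<bar> * N s t" "N (- 1 * s) (- 1 * t) = \<bar>- 1\<bar> * N s t"
    using assms unfolding absolute_normalized_norm_def by blast+
  ultimately show ?thesis by simp
qed

lemma c00_norm_eq:
  assumes N: "\<And>n. n \<ge> 1 \<Longrightarrow> absolute_normalized_norm (N n)"
    and x: "\<forall>j>n. x j = 0"
  shows "c00_norm N x = M_norm N n x"
proof -
  have nonneg: "M_norm N m x \<ge> 0" for m
    by (cases m) (simp_all add: absolute_normalized_norm_nonneg N)
  have first: "N m s 0 = \<bar>s\<bar>" if "m \<ge> 1" for m s
  proof -
    have "N m (s * 1) (s * 0) = \<bar>s\<bar> * N m 1 0" "N m 1 0 = 1"
      using N[OF that] unfolding absolute_normalized_norm_def by blast+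
    then show ?thesis by simp
  qed
  define l where "l = (LEAST n. \<forall>j>n. x j = 0)"
  have l: "\<forall>j>l. x j = 0" and "l \<le> n"
    unfolding l_def using x by (rule LeastI, rule Least_le)
  from \<open>l \<le> n\<close> have "M_norm N n x = M_norm N l x"
    by (induction rule: dec_induct) (use l nonneg first in auto)
  then show ?thesis by (simp add: c00_norm_def l_def)
qed

text \<open>\<open>A_space N J\<close> says that the Banach space \<open>'a\<close> together with the embedding \<open>J\<close> is
  the completion of \<open>c00\<close> in the norm \<open>c00_norm N\<close>: \<open>J\<close> is a linear isometry of \<open>c00\<close>
  onto a dense subspace. This determines the pair up to isometric isomorphism. Since the norm
  depends on real parameters, the completion cannot be one fixed type. Only the values
  of \<open>J\<close> on \<open>c00\<close> matter; the canonical basis vector \<open>e\<^sub>j\<close> is \<open>J\<close> of the \<open>j\<close>-th unit sequence.\<close>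

definition A_space ::
  "(nat \<Rightarrow> real \<Rightarrow> real \<Rightarrow> real) \<Rightarrow> ((nat \<Rightarrow> real) \<Rightarrow> 'a::banach) \<Rightarrow> bool" where
  "A_space N J \<longleftrightarrow>
     (\<forall>x\<in>c00. \<forall>y\<in>c00. J (\<lambda>j. x j + y j) = J x + J y) \<and>
     (\<forall>a. \<forall>x\<in>c00. J (\<lambda>j. a * x j) = a *\<^sub>R J x) \<and>
     (\<forall>x\<in>c00. norm (J x) = c00_norm N x) \<and>
     closure (J ` c00) = UNIV"

definition N_c :: "real \<Rightarrow> nat \<Rightarrow> real \<Rightarrow> real \<Rightarrow> real" where
  "N_c c n s t =
     root (2 * n) ((1 - c ^ (2 * n)) * \<bar>t\<bar> ^ (2 * n) + (s\<^sup>2 + c\<^sup>2 * t\<^sup>2) ^ n)"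

abbreviation X_space :: "real \<Rightarrow> ((nat \<Rightarrow> real) \<Rightarrow> 'a::banach) \<Rightarrow> bool" where
  "X_space c \<equiv> A_space (N_c c)"

lemma weighted_minkowski:
  fixes w a b a' b' :: real
  assumes n: "n \<ge> 1" and w: "w > 0" and nn: "a \<ge> 0" "b \<ge> 0" "a' \<ge> 0" "b' \<ge> 0"
  defines "r \<equiv> \<lambda>a b. root (2 * n) (w * a ^ (2 * n) + b ^ (2 * n))"
  shows "r (a + a') (b + b') \<le> r a b + r a' b'"
proof -
  have r0: "r x y \<ge> 0" for x y
    using w n by (simp add: r_def)
  have rp: "r x y ^ (2 * n) = w * x ^ (2 * n) + y ^ (2 * n)" for x y
    using w n by (simp add: r_def)
  have zero: "x = 0 \<and> y = 0" if "r x y = 0" for x y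
  proof -
    have "w * x ^ (2 * n) + y ^ (2 * n) = 0" using rp[of x y] n unfolding that by (simp add: power_0_left)
    moreover have "w * x ^ (2 * n) \<ge> 0" "y ^ (2 * n) \<ge> 0" using w by simp_all
    ultimately have "w * x ^ (2 * n) = 0" "y ^ (2 * n) = 0" by linarith+
    then show ?thesis using w by simp
  qed
  define \<alpha> \<beta> where "\<alpha> = r a b" and "\<beta> = r a' b'"
  show ?thesis
  proof (cases "\<alpha> = 0 \<or> \<beta> = 0")
    case True
    then consider "a = 0 \<and> b = 0" | "a' = 0 \<and> b' = 0"
      using zero unfolding \<alpha>_def \<beta>_def by blast
    then show ?thesis by cases (simp_all add: r0)
  next
    case False
    then have pos: "\<alpha> > 0" "\<beta> > 0" using r0 by (auto simp: \<alpha>_def \<beta>_def less_le)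
    define l where "l = \<beta> / (\<alpha> + \<beta>)"
    have l: "0 \<le> l" "l \<le> 1" "1 - l = \<alpha> / (\<alpha> + \<beta>)" using pos by (auto simp: l_def field_simps)
    have key: "(x + y) ^ (2 * n) \<le>
        (\<alpha> + \<beta>) ^ (2 * n) * ((1 - l) * (x / \<alpha>) ^ (2 * n) + l * (y / \<beta>) ^ (2 * n))" for x y
    proof -
      have "(1 - l) * (x / \<alpha>) = x / (\<alpha> + \<beta>)" "l * (y / \<beta>) = y / (\<alpha> + \<beta>)"
        unfolding l(3) using pos by (simp_all add: l_def)
      then have "x + y = (\<alpha> + \<beta>) * ((1 - l) * (x / \<alpha>) + l * (y / \<beta>))"
        using pos by (simp flip: add_divide_distrib)
      moreover have "((1 - l) * (x / \<alpha>) + l * (y / \<beta>)) ^ (2 * n)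
          \<le> (1 - l) * (x / \<alpha>) ^ (2 * n) + l * (y / \<beta>) ^ (2 * n)"
        using convex_onD[OF convex_power_even[of "2 * n"] l(1,2), of "x / \<alpha>" "y / \<beta>"] by simp
      ultimately show ?thesis
        using pos by (simp add: power_mult_distrib mult_left_mono)
    qed
    have \<alpha>p: "w * (a / \<alpha>) ^ (2 * n) + (b / \<alpha>) ^ (2 * n) = 1"
      and \<beta>p: "w * (a' / \<beta>) ^ (2 * n) + (b' / \<beta>) ^ (2 * n) = 1"
      using rp[of a b, symmetric] rp[of a' b', symmetric] pos
      by (simp_all add: \<alpha>_def \<beta>_def power_divide flip: add_divide_distrib)
    have "r (a + a') (b + b') ^ (2 * n) = w * (a + a') ^ (2 * n) + (b + b') ^ (2 * n)"
      by (rule rp)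
    also have "\<dots> \<le> w * ((\<alpha> + \<beta>) ^ (2 * n) * ((1 - l) * (a / \<alpha>) ^ (2 * n) + l * (a' / \<beta>) ^ (2 * n)))
        + (\<alpha> + \<beta>) ^ (2 * n) * ((1 - l) * (b / \<alpha>) ^ (2 * n) + l * (b' / \<beta>) ^ (2 * n))"
      using w by (intro add_mono mult_left_mono key) auto
    also have "\<dots> = (\<alpha> + \<beta>) ^ (2 * n) *
        ((1 - l) * (w * (a / \<alpha>) ^ (2 * n) + (b / \<alpha>) ^ (2 * n))
          + l * (w * (a' / \<beta>) ^ (2 * n) + (b' / \<beta>) ^ (2 * n)))"
      by (simp only: distrib_left ac_simps)
    also have "\<dots> = (\<alpha> + \<beta>) ^ (2 * n)" unfolding \<alpha>p \<beta>p by simp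
    finally have "r (a + a') (b + b') ^ (2 * n) \<le> (\<alpha> + \<beta>) ^ (2 * n)" .
    then show ?thesis
      using pos n by (simp add: \<alpha>_def \<beta>_def power_mono_iff r0)
  qed
qed

lemma absolute_normalized_norm_N_c:
  assumes c: "0 < c" "c < 1" and n: "n \<ge> 1"
  shows "absolute_normalized_norm (N_c c n)"
proof -
  define w where "w = 1 - c ^ (2 * n)"
  have w: "w > 0" using c n by (simp add: w_def power_less_one_iff)
  define q where "q = (\<lambda>s t. sqrt (s\<^sup>2 + (c * t)\<^sup>2))"
  have q0: "q s t \<ge> 0" for s t by (simp add: q_def)
  have N: "N_c c n s t = root (2 * n) (w * \<bar>t\<bar> ^ (2 * n) + q s t ^ (2 * n))" for s t
  proof -
    have "q s t ^ (2 * n) = (s\<^sup>2 + c\<^sup>2 * t\<^sup>2) ^ n"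
      by (simp add: q_def power_mult power_mult_distrib)
    then show ?thesis by (simp add: N_c_def w_def)
  qed
  show ?thesis
    unfolding absolute_normalized_norm_def
  proof (intro conjI allI impI)
    fix s t s' t' a :: real
    have mono: "N_c c n (s + s') (t + t') \<le>
        root (2 * n) (w * (\<bar>t\<bar> + \<bar>t'\<bar>) ^ (2 * n) + (q s t + q s' t') ^ (2 * n))"
    proof -
      have "q (s + s') (t + t') \<le> q s t + q s' t'"
        using real_sqrt_sum_squares_triangle_ineq[of s s' "c * t" "c * t'"]
        by (simp add: q_def distrib_left)
      then show ?thesis
        unfolding N using n w q0 abs_triangle_ineq[of t t']
        by (intro real_root_le_mono add_mono mult_left_mono power_mono) auto
    qed
    also have "\<dots> \<le> N_c c n s t + N_c c n s' t'"
      unfolding N using weighted_minkowski[OF n w, of "\<bar>t\<bar>" "q s t" "\<bar>t'\<bar>" "q s' t'"] q0 by simp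
    finally show "N_c c n (s + s') (t + t') \<le> N_c c n s t + N_c c n s' t'" .
    have "q (a * s) (a * t) = \<bar>a\<bar> * q s t"
    proof -
      have "(a * s)\<^sup>2 + (c * (a * t))\<^sup>2 = a\<^sup>2 * (s\<^sup>2 + (c * t)\<^sup>2)"
        by (simp add: power_mult_distrib algebra_simps)
      then show ?thesis by (simp add: q_def real_sqrt_mult)
    qed
    then have "w * \<bar>a * t\<bar> ^ (2 * n) + q (a * s) (a * t) ^ (2 * n) =
        \<bar>a\<bar> ^ (2 * n) * (w * \<bar>t\<bar> ^ (2 * n) + q s t ^ (2 * n))"
      by (simp only: abs_mult power_mult_distrib) (simp only: distrib_left ac_simps)
    then show "N_c c n (a * s) (a * t) = \<bar>a\<bar> * N_c c n s t"
      unfolding N using n by (simp only: real_root_mult) (simp add: real_root_power_cancel)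
  next
    fix s t :: real
    assume "N_c c n s t = 0"
    then have "w * \<bar>t\<bar> ^ (2 * n) + q s t ^ (2 * n) = 0" using n by (simp add: N)
    moreover have "w * \<bar>t\<bar> ^ (2 * n) \<ge> 0" "q s t ^ (2 * n) \<ge> 0" using w by simp_all
    ultimately have "w * \<bar>t\<bar> ^ (2 * n) = 0" "q s t ^ (2 * n) = 0" by linarith+
    then have "t = 0" "q s t = 0" using w n by auto
    then show "s = 0" "t = 0" by (auto simp: q_def)
  next
    fix s t :: real
    show "N_c c n s t = N_c c n \<bar>s\<bar> \<bar>t\<bar>" by (simp add: N_c_def)
  next
    show "N_c c n 1 0 = 1" using n by (simp add: N_c_def)
    show "N_c c n 0 1 = 1" using n by (simp add: N_c_def flip: power_mult)
  qed
qed

end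

theory Submission
  imports Defs
begin

text \<open>
  The norm of \<open>X\<^sub>c\<close> satisfies an upper 2-estimate with constant \<open>1\<close>:
  \<open>\<parallel>x + y\<parallel>\<^sup>2 \<le> \<parallel>x\<parallel>\<^sup>2 + \<parallel>y\<parallel>\<^sup>2\<close> whenever the support of \<open>x\<close> precedes that of \<open>y\<close>. The reason is
  that \<open>N\<^sub>n(s,t)\<^sup>2\<close>, as a function of \<open>s\<^sup>2\<close>, is \<open>1\<close>-Lipschitz (\<open>N_c_square_le_add\<close>). So if
  \<open>A\<close> is the norm of \<open>x\<close>, then the excess \<open>A\<^sup>2\<close> of the squared norm of \<open>x + y\<close> over that of
  \<open>y\<close>, present where the support of \<open>x\<close> ends, does not grow when the coordinates of \<open>y\<close> are
  added one by one (\<open>M_norm_square_add_le\<close>).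

  Dually, let \<open>x\<close> be a finitely supported vector of the unit ball that almost norms \<open>f\<close>. For \<open>y\<close>
  in the unit ball, supported after \<open>x\<close>, the upper 2-estimate gives
  \<open>f(x)\<^sup>2 + f(y)\<^sup>2 \<le> \<parallel>f\<parallel>\<^sup>2\<close>, which forces \<open>f(y)\<close> to be small (\<open>square_add_le_norm_square\<close>).
  If \<open>h\<close> is small on the finitely many basis vectors that \<open>x\<close> can use, then \<open>h\<close> is almost normed by
  some such \<open>y\<close>, because cutting off initial coordinates does not increase the norm. For
  \<open>a\<^sup>2 + b\<^sup>2 = 1\<close> the vector \<open>a x + b y\<close> lies in the unit ball, and \<open>f + h\<close> takes there nearly the
  value \<open>a \<parallel>f\<parallel> + b \<parallel>h\<parallel>\<close>. With \<open>(a, b)\<close> parallel to \<open>(\<parallel>f\<parallel>, \<parallel>h\<parallel>)\<close> this is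
  \<open>sqrt (\<parallel>f\<parallel>\<^sup>2 + \<parallel>h\<parallel>\<^sup>2)\<close> (\<open>norm_add_ge\<close>).

  A weakly null sequence \<open>h\<^sub>k\<close> in the dual tends to \<open>0\<close> at every vector, in particular at the basis
  vectors, so the estimate applies to all large \<open>k\<close> with an arbitrarily small error
  (\<open>eventually_norm_add_ge\<close>). It is also bounded, so \<open>L\<close> is finite, and the inequality for the
  upper limits follows. As \<open>L < sqrt (\<parallel>f\<parallel>\<^sup>2 + L\<^sup>2)\<close> for \<open>f \<noteq> 0\<close>, the Opial
  property is immediate.
\<close>

section \<open>An upper 2-estimate for consecutive blocks\<close>

lemma power_increment_mono:
  fixes a p g :: real
  assumes "0 \<le> a" "0 \<le> p" "p \<le> g"
  shows "(a + p) ^ n - p ^ n \<le> (a + g) ^ n - g ^ n"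
proof (induction n)
  case 0
  then show ?case by simp
next
  case (Suc n)
  have "(a + p) ^ Suc n - p ^ Suc n = (a + p) * ((a + p) ^ n - p ^ n) + a * p ^ n"
    by (simp add: algebra_simps)
  also have "\<dots> \<le> (a + g) * ((a + g) ^ n - g ^ n) + a * g ^ n"
    using assms Suc by (intro add_mono mult_mono power_mono) (auto intro: power_mono)
  also have "\<dots> = (a + g) ^ Suc n - g ^ Suc n"
    by (simp add: algebra_simps)
  finally show ?case .
qed

lemma N_c_power:
  assumes "0 < c" "c < 1" "n \<ge> 1"
  shows "N_c c n s t ^ (2 * n) = (1 - c ^ (2 * n)) * \<bar>t\<bar> ^ (2 * n) + (s\<^sup>2 + c\<^sup>2 * t\<^sup>2) ^ n"
proof -
  have "c ^ (2 * n) \<le> 1" using assms by (simp add: power_le_one)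
  then show ?thesis
    unfolding N_c_def using assms by (intro real_root_pow_pos2 add_nonneg_nonneg mult_nonneg_nonneg) auto
qed

lemma N_c_nonneg:
  assumes "0 < c" "c < 1" "n \<ge> 1"
  shows "0 \<le> N_c c n s t"
  using absolute_normalized_norm_nonneg[OF absolute_normalized_norm_N_c[OF assms]] .

lemma N_c_mono:
  assumes c: "0 < c" "c < 1" and n: "n \<ge> 1" and st: "\<bar>s\<bar> \<le> \<bar>s'\<bar>" "\<bar>t\<bar> \<le> \<bar>t'\<bar>"
  shows "N_c c n s t \<le> N_c c n s' t'"
proof -
  have "c ^ (2 * n) \<le> 1" using c by (simp add: power_le_one)
  moreover have "s\<^sup>2 \<le> s'\<^sup>2" "t\<^sup>2 \<le> t'\<^sup>2" using st by (simp_all add: abs_le_square_iff)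
  ultimately show ?thesis
    unfolding N_c_def using n st(2)
    by (intro real_root_le_mono add_mono mult_left_mono power_mono[of "_ + _"] power_mono[of "\<bar>_\<bar>"]) auto
qed

text \<open>With \<open>p = b\<^sup>2 + c\<^sup>2 t\<^sup>2\<close> and \<open>G = N(b,t)\<^sup>2 \<ge> p\<close>, replacing \<open>b\<^sup>2\<close> by \<open>a\<^sup>2 + b\<^sup>2\<close> adds
  \<open>(a\<^sup>2 + p)^n - p^n\<close> to \<open>G^n\<close>, and this is at most \<open>(a\<^sup>2 + G)^n - G^n\<close> by convexity of the
  power: as a function of \<open>s\<^sup>2\<close>, the square of the norm grows at most with slope \<open>1\<close>.\<close>

lemma N_c_square_le_add:
  assumes c: "0 < c" "c < 1" and n: "n \<ge> 1" and s: "s\<^sup>2 \<le> a\<^sup>2 + b\<^sup>2"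
  shows "(N_c c n s t)\<^sup>2 \<le> a\<^sup>2 + (N_c c n b t)\<^sup>2"
proof -
  define W where "W = (1 - c ^ (2 * n)) * \<bar>t\<bar> ^ (2 * n)"
  define p where "p = b\<^sup>2 + c\<^sup>2 * t\<^sup>2"
  define G where "G = (N_c c n b t)\<^sup>2"
  have "c ^ (2 * n) \<le> 1" using c by (simp add: power_le_one)
  then have W: "0 \<le> W" by (simp add: W_def)
  have p: "0 \<le> p" by (simp add: p_def)
  have G: "G ^ n = W + p ^ n"
    using N_c_power[OF c n, of b t] by (simp add: G_def W_def p_def flip: power_mult)
  have "p \<le> G"
    using W G n by (intro power_le_imp_le_base[of p "n - 1"]) (auto simp: G_def)
  have "((N_c c n s t)\<^sup>2) ^ n = W + (s\<^sup>2 + c\<^sup>2 * t\<^sup>2) ^ n"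
    using N_c_power[OF c n, of s t] by (simp add: W_def flip: power_mult)
  also have "\<dots> \<le> W + (a\<^sup>2 + p) ^ n"
    using s by (intro add_left_mono power_mono) (auto simp: p_def)
  also have "\<dots> \<le> (a\<^sup>2 + G) ^ n"
    using power_increment_mono[of "a\<^sup>2" p G n] p \<open>p \<le> G\<close> G by simp
  finally show ?thesis
    using n by (simp add: power_mono_iff G_def)
qed

lemma M_norm_cong:
  assumes "\<And>j. j \<le> n \<Longrightarrow> x j = y j"
  shows "M_norm N n x = M_norm N n y"
  using assms by (induction n) auto

lemma M_norm_nonneg:
  assumes "0 < c" "c < 1"
  shows "0 \<le> M_norm (N_c c) n x"
  using assms by (cases n) (auto intro: N_c_nonneg)

lemma M_norm_mono:
  assumes c: "0 < c" "c < 1" and xy: "\<And>j. \<bar>x j\<bar> \<le> \<bar>y j\<bar>"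
  shows "M_norm (N_c c) n x \<le> M_norm (N_c c) n y"
proof (induction n)
  case (Suc n)
  then show ?case
    using xy M_norm_nonneg[OF c] by (auto intro!: N_c_mono c)
qed (use xy in auto)

lemma abs_le_M_norm:
  assumes c: "0 < c" "c < 1" and "j \<le> n"
  shows "\<bar>x j\<bar> \<le> M_norm (N_c c) n x"
  using \<open>j \<le> n\<close>
proof (induction n)
  case (Suc n)
  note nrm = absolute_normalized_norm_N_c[OF c, of "Suc n"]
  have scale: "N_c c (Suc n) (r * s) (r * t) = \<bar>r\<bar> * N_c c (Suc n) s t" for r s t
    using nrm unfolding absolute_normalized_norm_def by simp
  have unit: "N_c c (Suc n) 1 0 = 1" "N_c c (Suc n) 0 1 = 1"
    using nrm unfolding absolute_normalized_norm_def by simp_all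
  let ?M = "M_norm (N_c c) n x"
  have "?M \<le> N_c c (Suc n) ?M \<bar>x (Suc n)\<bar>"
    using N_c_mono[OF c, of "Suc n" ?M ?M 0 "\<bar>x (Suc n)\<bar>"] scale[of ?M 1 0] unit(1)
      M_norm_nonneg[OF c, of n x] by simp
  moreover have "\<bar>x (Suc n)\<bar> \<le> N_c c (Suc n) ?M \<bar>x (Suc n)\<bar>"
    using N_c_mono[OF c, of "Suc n" 0 ?M "\<bar>x (Suc n)\<bar>" "\<bar>x (Suc n)\<bar>"]
      scale[of "\<bar>x (Suc n)\<bar>" 0 1] unit(2) by simp
  ultimately show ?case
    using Suc by (cases "j = Suc n") auto
qed auto

text \<open>Up to index \<open>m\<close> only \<open>x\<close> contributes. From then on each step replaces a squared norm by
  one that exceeds its counterpart for \<open>y\<close> alone by no more than before, since \<open>N_c\<close> is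
  \<open>1\<close>-Lipschitz in the squares.\<close>

lemma M_norm_square_add_le:
  assumes c: "0 < c" "c < 1"
    and x: "\<And>j. j > m \<Longrightarrow> x j = 0" and y: "\<And>j. j \<le> m \<Longrightarrow> y j = 0" and "m \<le> n"
  shows "(M_norm (N_c c) n (\<lambda>j. x j + y j))\<^sup>2 \<le> (M_norm (N_c c) m x)\<^sup>2 + (M_norm (N_c c) n y)\<^sup>2"
  using \<open>m \<le> n\<close>
proof (induction n rule: dec_induct)
  case base
  have "M_norm (N_c c) m (\<lambda>j. x j + y j) = M_norm (N_c c) m x"
    by (rule M_norm_cong) (simp add: y)
  then show ?case by simp
next
  case (step n)
  then show ?case
    using N_c_square_le_add[OF c _ step.IH, of "Suc n"] x by simp
qed

section \<open>The space and its coordinate projections\<close>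

definition head_part :: "nat \<Rightarrow> (nat \<Rightarrow> real) \<Rightarrow> nat \<Rightarrow> real" where
  "head_part m x = (\<lambda>j. if j \<le> m then x j else 0)"

definition tail_part :: "nat \<Rightarrow> (nat \<Rightarrow> real) \<Rightarrow> nat \<Rightarrow> real" where
  "tail_part m x = (\<lambda>j. if j \<le> m then 0 else x j)"

lemma c00_bound:
  assumes "x \<in> c00"
  obtains n where "\<And>j. j > n \<Longrightarrow> x j = 0"
proof -
  have "finite {j. x j \<noteq> 0}" using assms by (simp add: c00_def)
  then obtain n where "\<forall>j\<in>{j. x j \<noteq> 0}. j \<le> n"
    using finite_nat_set_iff_bounded_le by blast
  then show ?thesis using that[of n] by force
qed

lemma c00I:
  assumes "\<And>j. j > n \<Longrightarrow> x j = 0"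
  shows "x \<in> c00"
proof -
  have "{j. x j \<noteq> 0} \<subseteq> {..n}" using assms by (auto simp: not_less[symmetric])
  then show ?thesis unfolding c00_def by (auto intro: finite_subset)
qed

lemma c00_scale: "x \<in> c00 \<Longrightarrow> (\<lambda>j. a * x j) \<in> c00"
  unfolding c00_def by (auto elim: rev_finite_subset)

lemma head_part_c00: "head_part m x \<in> c00"
  by (rule c00I[of m]) (simp add: head_part_def)

lemma tail_part_c00: "x \<in> c00 \<Longrightarrow> tail_part m x \<in> c00"
  unfolding c00_def tail_part_def by (auto elim: rev_finite_subset)

context
  fixes c :: real and J :: "(nat \<Rightarrow> real) \<Rightarrow> 'a::banach"
  assumes c: "0 < c" "c < 1" and X: "X_space c J"
begin

lemma J_add: "x \<in> c00 \<Longrightarrow> y \<in> c00 \<Longrightarrow> J (\<lambda>j. x j + y j) = J x + J y"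
  using X unfolding A_space_def by blast

lemma J_scale: "x \<in> c00 \<Longrightarrow> J (\<lambda>j. a * x j) = a *\<^sub>R J x"
  using X unfolding A_space_def by blast

lemma J_zero: "J (\<lambda>j. 0) = 0"
  using J_scale[OF c00I[of 0 "\<lambda>j. 0"], of 0] by simp

lemma norm_J:
  assumes "\<And>j. j > n \<Longrightarrow> x j = 0"
  shows "norm (J x) = M_norm (N_c c) n x"
proof -
  have "norm (J x) = c00_norm (N_c c) x"
    using X c00I[of n x] assms unfolding A_space_def by blast
  also have "\<dots> = M_norm (N_c c) n x"
    using assms by (intro c00_norm_eq absolute_normalized_norm_N_c c) auto
  finally show ?thesis .
qed

lemma J_head_tail: "x \<in> c00 \<Longrightarrow> J x = J (head_part m x) + J (tail_part m x)"
  by (simp add: head_part_c00 tail_part_c00 flip: J_add)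
    (simp add: head_part_def tail_part_def if_distrib cong: if_cong)

lemma J_head_part: "J (head_part m x) = (\<Sum>i\<le>m. x i *\<^sub>R J (\<lambda>j. if j = i then 1 else 0))"
proof -
  have e: "(\<lambda>j. if j = i then 1 else 0 :: real) \<in> c00" for i :: nat
    by (rule c00I[of i]) auto
  show ?thesis
  proof (induction m)
    case 0
    have "head_part 0 x = (\<lambda>j. x 0 * (if j = 0 then 1 else 0))"
      by (auto simp: head_part_def)
    then show ?case by (simp only: J_scale[OF e]) simp
  next
    case (Suc m)
    have "head_part (Suc m) x =
        (\<lambda>j. head_part m x j + x (Suc m) * (if j = Suc m then 1 else 0))"
      by (auto simp: head_part_def fun_eq_iff le_Suc_eq)
    then show ?case
      using Suc by (simp only: J_add[OF head_part_c00 c00_scale[OF e]] J_scale[OF e]) simp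
  qed
qed

text \<open>Together with \<open>J_head_part\<close> this bounds a functional on initial segments of unit vectors by
  its values on finitely many basis vectors.\<close>

lemma coordinate_le_norm:
  assumes "x \<in> c00"
  shows "\<bar>x i\<bar> \<le> norm (J x)"
proof -
  obtain n where n: "\<And>j. j > n \<Longrightarrow> x j = 0" using c00_bound[OF assms] by blast
  show ?thesis
    using abs_le_M_norm[OF c, of i n x] norm_J[of n x] n M_norm_nonneg[OF c, of n x]
    by (cases "i \<le> n") auto
qed

lemma norm_tail_part_le:
  assumes "x \<in> c00"
  shows "norm (J (tail_part m x)) \<le> norm (J x)"
proof -
  obtain n where n: "\<And>j. j > n \<Longrightarrow> x j = 0" using c00_bound[OF assms] by blast
  then have "tail_part m x j = 0" if "j > n" for j
    using that by (simp add: tail_part_def)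
  with n show ?thesis
    by (auto simp: norm_J[of n] tail_part_def intro!: M_norm_mono c)
qed

lemma norm_square_add_le:
  assumes x: "\<And>j. j > m \<Longrightarrow> x j = 0" and y: "\<And>j. j \<le> m \<Longrightarrow> y j = 0" and "y \<in> c00"
  shows "(norm (J x + J y))\<^sup>2 \<le> (norm (J x))\<^sup>2 + (norm (J y))\<^sup>2"
proof -
  obtain n' where n': "\<And>j. j > n' \<Longrightarrow> y j = 0" using c00_bound[OF \<open>y \<in> c00\<close>] by blast
  define n where "n = max m n'"
  have "norm (J x + J y) = M_norm (N_c c) n (\<lambda>j. x j + y j)"
    using J_add[OF c00I[of m x] \<open>y \<in> c00\<close>] norm_J[of n "\<lambda>j. x j + y j"] x n'
    by (simp add: n_def)
  moreover have "norm (J x) = M_norm (N_c c) m x" using x by (rule norm_J)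
  moreover have "norm (J y) = M_norm (N_c c) n y" using n' by (intro norm_J) (auto simp: n_def)
  ultimately show ?thesis
    using M_norm_square_add_le[OF c, of m x y n] x y by (simp add: n_def)
qed

lemma norm_combination_le:
  assumes x: "\<And>j. j > m \<Longrightarrow> x j = 0" and y: "\<And>j. j \<le> m \<Longrightarrow> y j = 0" "y \<in> c00"
    and "norm (J x) \<le> 1" "norm (J y) \<le> 1"
  shows "norm (a *\<^sub>R J x + b *\<^sub>R J y) \<le> sqrt (a\<^sup>2 + b\<^sup>2)"
proof -
  have "(norm (a *\<^sub>R J x + b *\<^sub>R J y))\<^sup>2 \<le> (norm (a *\<^sub>R J x))\<^sup>2 + (norm (b *\<^sub>R J y))\<^sup>2"
    using norm_square_add_le[of m "\<lambda>j. a * x j" "\<lambda>j. b * y j"] x y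
    by (simp add: J_scale[OF c00I[of m x]] J_scale[OF y(2)] c00_scale)
  also have "\<dots> \<le> a\<^sup>2 + b\<^sup>2"
    using assms(4,5) by (intro add_mono) (auto simp: power_mult_distrib abs_square_le_1 intro!: mult_left_le)
  finally show ?thesis by (rule real_le_rsqrt)
qed

section \<open>Functionals\<close>

text \<open>If \<open>f(v) \<le> K \<parallel>v\<parallel>\<close> with \<open>K < \<parallel>f\<parallel>\<close> held on the finitely supported vectors, it would hold
  everywhere by density.\<close>

lemma almost_norming:
  fixes f :: "'a \<Rightarrow>\<^sub>L real"
  assumes "e > 0"
  obtains x where "x \<in> c00" "norm (J x) \<le> 1" "f (J x) > norm f - e"
proof (rule ccontr)
  assume "\<not> thesis"
  with that have le: "f (J x) \<le> norm f - e" if "x \<in> c00" "norm (J x) \<le> 1" for x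
    using that by force
  have K: "0 \<le> norm f - e"
    using le[of "\<lambda>j. 0"] c00I[of 0 "\<lambda>j. 0"] by (simp add: J_zero blinfun.zero_right)
  have "f (J x) \<le> (norm f - e) * norm (J x)" if "x \<in> c00" for x
  proof (cases "J x = 0")
    case False
    have "J (\<lambda>j. inverse (norm (J x)) * x j) = inverse (norm (J x)) *\<^sub>R J x"
      using that by (rule J_scale)
    then show ?thesis
      using le[OF c00_scale[OF that], of "inverse (norm (J x))"] False
      by (simp add: blinfun.scaleR_right field_simps)
  qed (simp add: blinfun.zero_right)
  then have "closure (J ` c00) \<subseteq> {v. f v \<le> (norm f - e) * norm v}"
    by (intro closure_minimal closed_Collect_le continuous_intros) auto
  then have bound: "f v \<le> (norm f - e) * norm v" for v
    using X unfolding A_space_def by auto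
  have "norm f \<le> norm f - e"
  proof (rule norm_blinfun_bound[OF K])
    show "norm (f v) \<le> (norm f - e) * norm v" for v
      using bound[of v] bound[of "- v"] by (simp add: blinfun.minus_right abs_le_iff)
  qed
  with assms show False by simp
qed

text \<open>The dual form of the upper 2-estimate, obtained by evaluating \<open>f\<close> at the combination of
  \<open>x\<close> and \<open>y\<close> whose coefficients are the values \<open>f(x)\<close> and \<open>f(y)\<close> themselves.\<close>

lemma square_add_le_norm_square:
  fixes f :: "'a \<Rightarrow>\<^sub>L real"
  assumes x: "\<And>j. j > m \<Longrightarrow> x j = 0" and y: "\<And>j. j \<le> m \<Longrightarrow> y j = 0" "y \<in> c00"
    and "norm (J x) \<le> 1" "norm (J y) \<le> 1"
  shows "(f (J x))\<^sup>2 + (f (J y))\<^sup>2 \<le> (norm f)\<^sup>2"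
proof -
  let ?a = "f (J x)" and ?b = "f (J y)"
  define S where "S = sqrt (?a\<^sup>2 + ?b\<^sup>2)"
  have S: "S\<^sup>2 = ?a\<^sup>2 + ?b\<^sup>2" "0 \<le> S" by (simp_all add: S_def)
  have "S * S = f (?a *\<^sub>R J x + ?b *\<^sub>R J y)"
    using S by (simp add: blinfun.add_right blinfun.scaleR_right power2_eq_square)
  also have "\<dots> \<le> norm f * norm (?a *\<^sub>R J x + ?b *\<^sub>R J y)"
    using norm_blinfun[of f] by (metis abs_le_D1 real_norm_def)
  also have "\<dots> \<le> norm f * S"
    using norm_combination_le[OF assms] unfolding S_def by (intro mult_left_mono) auto
  finally have "S \<le> norm f"
    using S(2) by (cases "S = 0") auto
  then show ?thesis using S by (metis power_mono)
qed

text \<open>The error terms are: \<open>d\<close>, by which \<open>x\<close> fails to norm \<open>f\<close>; \<open>e\<close>, a bound for \<open>f\<close> on the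
  unit vectors supported after \<open>x\<close>, where
  \<open>f(y)\<^sup>2 \<le> \<parallel>f\<parallel>\<^sup>2 - f(x)\<^sup>2 = (\<parallel>f\<parallel> + f(x)) (\<parallel>f\<parallel> - f(x)) \<le> 2 \<parallel>f\<parallel> d\<close>; the value of \<open>h\<close> at \<open>x\<close>; and
  the loss in \<open>h\<close> when a vector norming it is cut down to its coordinates beyond \<open>m\<close>.\<close>

lemma norm_add_ge:
  fixes f h :: "'a \<Rightarrow>\<^sub>L real"
  assumes x: "\<And>j. j > m \<Longrightarrow> x j = 0" and "norm (J x) \<le> 1"
    and fx: "f (J x) \<ge> norm f - d" and e: "0 \<le> d" "2 * norm f * d \<le> e\<^sup>2" "0 \<le> e"
  shows "norm (f + h) \<ge> sqrt ((norm f)\<^sup>2 + (norm h)\<^sup>2) - d - e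
    - \<bar>h (J x)\<bar> - (\<Sum>i\<le>m. \<bar>h (J (\<lambda>j. if j = i then 1 else 0))\<bar>)"
proof -
  define R where "R = sqrt ((norm f)\<^sup>2 + (norm h)\<^sup>2)"
  define s where "s = (\<Sum>i\<le>m. \<bar>h (J (\<lambda>j. if j = i then 1 else 0))\<bar>)"
  have s: "0 \<le> s" unfolding s_def by (intro sum_nonneg) auto
  have "R - d - e - \<bar>h (J x)\<bar> - s - r \<le> norm (f + h)" if "r > 0" for r
  proof (cases "R = 0")
    case True
    have "0 \<le> norm (f + h)" by (rule norm_ge_zero)
    then show ?thesis using True e s that abs_ge_zero[of "h (J x)"] by linarith
  next
    case False
    have R: "R > 0" "R * R = norm f * norm f + norm h * norm h"
      using False by (auto simp: R_def less_le power2_eq_square)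
    \<comment> \<open>the point of the unit circle in the direction of \<open>(\<parallel>f\<parallel>, \<parallel>h\<parallel>)\<close>, where \<open>a \<parallel>f\<parallel> + b \<parallel>h\<parallel>\<close> is maximal\<close>
    define a b where "a = norm f / R" and "b = norm h / R"
    have "(norm f * norm f + norm h * norm h) / R = R"
      using R by (metis nonzero_mult_div_cancel_left less_irrefl)
    then have ab: "a * norm f + b * norm h = R" "a\<^sup>2 + b\<^sup>2 = 1" "0 \<le> a" "0 \<le> b"
      using R by (auto simp: a_def b_def power_divide power2_eq_square simp flip: add_divide_distrib)
    have "a\<^sup>2 \<le> 1" "b\<^sup>2 \<le> 1"
      using ab(2) zero_le_power2[of a] zero_le_power2[of b] by linarith+
    then have ab1: "a \<le> 1" "b \<le> 1" using ab by (auto simp: abs_square_le_1)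
    obtain z where z: "z \<in> c00" "norm (J z) \<le> 1" "h (J z) > norm h - r"
      using almost_norming[OF \<open>r > 0\<close>, of h] .
    define y where "y = tail_part m z"
    have y1: "\<And>j. j \<le> m \<Longrightarrow> y j = 0"
      by (simp add: y_def tail_part_def)
    have y2: "y \<in> c00" "norm (J y) \<le> 1"
      using z norm_tail_part_le[OF z(1), of m] by (simp_all add: y_def tail_part_c00)
    note y = y1 y2
    have "\<bar>h (J (head_part m z))\<bar> \<le> s"
    proof -
      have "\<bar>h (J (head_part m z))\<bar> = \<bar>\<Sum>i\<le>m. z i * h (J (\<lambda>j. if j = i then 1 else 0))\<bar>"
        by (simp add: J_head_part blinfun.sum_right blinfun.scaleR_right)
      also have "\<dots> \<le> (\<Sum>i\<le>m. \<bar>z i\<bar> * \<bar>h (J (\<lambda>j. if j = i then 1 else 0))\<bar>)"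
        using sum_abs by (simp flip: abs_mult)
      also have "\<dots> \<le> s"
        unfolding s_def using coordinate_le_norm[OF z(1)] z(2)
        by (intro sum_mono) (meson abs_ge_zero mult_left_le_one_le order_trans)
      finally show ?thesis .
    qed
    then have hy: "h (J y) \<ge> norm h - r - s"
      using z(3) J_head_tail[OF z(1), of m] by (simp add: y_def blinfun.add_right)
    have fy: "\<bar>f (J y)\<bar> \<le> e"
    proof -
      have "\<bar>f (J x)\<bar> \<le> norm f"
        using norm_blinfun[of f "J x"] mult_left_le[OF \<open>norm (J x) \<le> 1\<close> norm_ge_zero[of f]] by simp
      have "(f (J y))\<^sup>2 \<le> (norm f)\<^sup>2 - (f (J x))\<^sup>2"
        using square_add_le_norm_square[of m x y f] x y \<open>norm (J x) \<le> 1\<close> by simp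
      also have "\<dots> = (norm f + f (J x)) * (norm f - f (J x))"
        by (simp add: power2_eq_square algebra_simps)
      also have "\<dots> \<le> (2 * norm f) * d"
        using \<open>\<bar>f (J x)\<bar> \<le> norm f\<close> fx by (intro mult_mono) auto
      also have "\<dots> \<le> e\<^sup>2" by (rule e)
      finally show ?thesis using e(3) by (simp add: abs_le_square_iff[symmetric])
    qed
    have 1: "a * f (J x) \<ge> a * norm f - d"
      using mult_left_mono[OF fx ab(3)] mult_left_le_one_le[OF e(1) ab(3) ab1(1)]
      by (simp add: algebra_simps)
    have 2: "b * h (J y) \<ge> b * norm h - r - s"
      using mult_left_mono[OF hy ab(4)] mult_left_le_one_le[of "r + s", OF _ ab(4) ab1(2)] s that
      by (simp add: algebra_simps)
    have 3: "b * f (J y) \<ge> - e"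
      using fy mult_left_le_one_le[of "\<bar>f (J y)\<bar>", OF _ ab(4) ab1(2)]
        abs_mult[of b "f (J y)"] ab(4) by simp
    have 4: "a * h (J x) \<ge> - \<bar>h (J x)\<bar>"
      using mult_left_le_one_le[of "\<bar>h (J x)\<bar>", OF _ ab(3) ab1(1)]
        abs_mult[of a "h (J x)"] ab(3) by simp
    have "R - d - e - \<bar>h (J x)\<bar> - s - r \<le> a * f (J x) + b * h (J y) + b * f (J y) + a * h (J x)"
      using 1 2 3 4 ab(1) by linarith
    also have "\<dots> = (f + h) (a *\<^sub>R J x + b *\<^sub>R J y)"
      by (simp add: blinfun.add_right blinfun.add_left blinfun.scaleR_right algebra_simps)
    also have "\<dots> \<le> norm (f + h) * norm (a *\<^sub>R J x + b *\<^sub>R J y)"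
      using norm_blinfun[of "f + h"] by (metis abs_le_D1 real_norm_def)
    also have "\<dots> \<le> norm (f + h) * 1"
      using norm_combination_le[of m x y a b] x y \<open>norm (J x) \<le> 1\<close> ab(2)
      by (intro mult_left_mono) auto
    finally show ?thesis by simp
  qed
  then have "R - d - e - \<bar>h (J x)\<bar> - s \<le> norm (f + h)"
    by (metis diff_le_eq field_le_epsilon)
  then show ?thesis by (simp only: R_def s_def)
qed

text \<open>The vector \<open>x\<close> in \<open>norm_add_ge\<close> depends on \<open>f\<close> and \<open>e\<close> only. It is fixed before \<open>k\<close>, so
  convergence of \<open>h\<^sub>k\<close> to \<open>0\<close> at finitely many vectors suffices.\<close>

lemma eventually_norm_add_ge:
  fixes f :: "'a \<Rightarrow>\<^sub>L real" and h :: "nat \<Rightarrow> 'a \<Rightarrow>\<^sub>L real"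
  assumes h: "\<And>v. (\<lambda>k. h k v) \<longlonglongrightarrow> 0" and "e > 0"
  shows "\<forall>\<^sub>F k in sequentially. norm (f + h k) \<ge> sqrt ((norm f)\<^sup>2 + (norm (h k))\<^sup>2) - e"
proof -
  \<comment> \<open>small enough for \<open>2 \<parallel>f\<parallel> d \<le> (e / 4)\<^sup>2\<close>; the \<open>+ 1\<close> covers \<open>f = 0\<close>\<close>
  define d where "d = min (e / 4) ((e / 4)\<^sup>2 / (2 * norm f + 1))"
  have n1: "0 < 2 * norm f + 1" using norm_ge_zero[of f] by linarith
  then have d: "0 < d" "d \<le> e / 4" unfolding d_def using \<open>e > 0\<close> by (simp, intro min.cobounded1)
  have "2 * norm f * d \<le> (2 * norm f + 1) * ((e / 4)\<^sup>2 / (2 * norm f + 1))"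
    using d(1) n1 by (intro mult_mono) (auto simp: d_def)
  then have d2: "2 * norm f * d \<le> (e / 4)\<^sup>2" using n1 by simp
  obtain x where x: "x \<in> c00" "norm (J x) \<le> 1" "f (J x) > norm f - d"
    using almost_norming[OF d(1), of f] .
  obtain m where m: "\<And>j. j > m \<Longrightarrow> x j = 0" using c00_bound[OF x(1)] by blast
  let ?err = "\<lambda>k. \<bar>h k (J x)\<bar> + (\<Sum>i\<le>m. \<bar>h k (J (\<lambda>j. if j = i then 1 else 0))\<bar>)"
  have "?err \<longlonglongrightarrow> \<bar>0\<bar> + (\<Sum>i\<le>m. \<bar>0\<bar>)"
    by (intro tendsto_intros h)
  then have "\<forall>\<^sub>F k in sequentially. ?err k < e / 2"
    using \<open>e > 0\<close> by (intro order_tendstoD) auto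
  then show ?thesis
  proof eventually_elim
    case (elim k)
    have "norm (f + h k) \<ge> sqrt ((norm f)\<^sup>2 + (norm (h k))\<^sup>2) - d - e / 4 - \<bar>h k (J x)\<bar>
        - (\<Sum>i\<le>m. \<bar>h k (J (\<lambda>j. if j = i then 1 else 0))\<bar>)"
      using x d d2 \<open>e > 0\<close> by (intro norm_add_ge m) auto
    then show ?case using elim d(2) by linarith
  qed
qed

end

section \<open>Uniform boundedness and passage to the upper limit\<close>

text \<open>By the Baire category theorem one of the closed sets on which the whole sequence is bounded by
  \<open>n\<close> contains a ball. A small vector is a difference of two points of that ball, which turns
  the bound \<open>n\<close> into the norm bound \<open>2 n / r\<close>.\<close>

lemma uniform_boundedness:
  fixes h :: "nat \<Rightarrow> 'a::banach \<Rightarrow>\<^sub>L 'b::real_normed_vector"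
  assumes "\<And>v. Bseq (\<lambda>k. h k v)"
  shows "Bseq h"
proof -
  define F where "F n = {v. \<forall>k. norm (h k v) \<le> real n}" for n
  have closed: "closed (F n)" for n
    unfolding F_def by (intro closed_Collect_all closed_Collect_le continuous_intros)
  have cover: "(\<Union>n. F n) = UNIV"
  proof -
    have "\<exists>n. v \<in> F n" for v
    proof -
      obtain K where "\<forall>k. norm (h k v) \<le> K" using assms[of v] by (auto simp: Bseq_def)
      moreover obtain n where "K \<le> real n" using real_arch_simple by blast
      ultimately show ?thesis unfolding F_def using order_trans by blast
    qed
    then show ?thesis by auto
  qed
  have "\<exists>n. interior (F n) \<noteq> {}"
  proof (rule ccontr)
    assume "\<not> ?thesis"
    then have "euclidean interior_of \<Union> (range F) = {}"
      using closed by (intro Baire_category_alt) (auto simp: completely_metrizable_space_euclidean)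
    then show False using cover by simp
  qed
  then obtain n v where "v \<in> interior (F n)" by blast
  then obtain r where r: "r > 0" "cball v r \<subseteq> F n"
    using mem_interior_cball by blast
  have "norm (h k) \<le> 2 * real n / r" for k
  proof (rule norm_blinfun_bound)
    fix w
    show "norm (h k w) \<le> 2 * real n / r * norm w"
    proof (cases "w = 0")
      case False
      define u where "u = (r / norm w) *\<^sub>R w"
      have "norm u = r" using r False by (simp add: u_def)
      then have "v + u \<in> F n" "v \<in> F n" using r by (auto simp: dist_norm)
      then have "norm (h k (v + u) - h k v) \<le> real n + real n"
        unfolding F_def by (intro norm_triangle_le_diff add_mono) auto
      then have "norm (h k u) \<le> 2 * real n" by (simp add: blinfun.add_right)
      then show ?thesis
        using r False by (simp add: u_def blinfun.scaleR_right field_simps)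
    qed (simp add: blinfun.zero_right)
  qed (use r in auto)
  then show ?thesis by (auto intro: BseqI')
qed

text \<open>Evaluation at a vector is a bounded linear functional on the dual.\<close>

lemma weakly_null_pointwise:
  fixes h :: "nat \<Rightarrow> 'a::real_normed_vector \<Rightarrow>\<^sub>L real"
  assumes "weakly_null h"
  shows "(\<lambda>k. h k v) \<longlonglongrightarrow> 0"
proof -
  have "(\<lambda>k. blinfun_apply (Blinfun (\<lambda>g :: 'a \<Rightarrow>\<^sub>L real. g v)) (h k)) \<longlonglongrightarrow> 0"
    using assms unfolding weakly_null_def by blast
  then show ?thesis
    by (simp add: bounded_linear_Blinfun_apply blinfun.bounded_linear_left)
qed

lemma limsup_norm_real:
  assumes "Bseq h"
  obtains L where "limsup (\<lambda>k. ereal (norm (h k))) = ereal L" "0 \<le> L"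
proof -
  obtain K where K: "\<And>k. norm (h k) \<le> K" using assms by (auto simp: Bseq_def)
  have "limsup (\<lambda>k. ereal (norm (h k))) \<le> ereal K"
    using K by (intro Limsup_bounded) auto
  moreover have "0 \<le> limsup (\<lambda>k. ereal (norm (h k)))"
    by (intro le_Limsup) auto
  ultimately show ?thesis
    using that by (cases "limsup (\<lambda>k. ereal (norm (h k)))") auto
qed

text \<open>The map \<open>u \<mapsto> sqrt (A\<^sup>2 + u\<^sup>2)\<close> is increasing on the nonnegative reals: a bound \<open>q\<close> on its
  values that is smaller than its value at \<open>L\<close> would keep \<open>u\<close> below a number smaller than \<open>L\<close>.\<close>

lemma limsup_sqrt_le:
  fixes u w :: "nat \<Rightarrow> real"
  assumes ev: "\<And>e. e > 0 \<Longrightarrow> \<forall>\<^sub>F k in sequentially. w k \<ge> sqrt (A\<^sup>2 + (u k)\<^sup>2) - e"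
    and L: "limsup (\<lambda>k. ereal (u k)) = ereal L" "0 \<le> L"
  shows "ereal (sqrt (A\<^sup>2 + L\<^sup>2)) \<le> limsup (\<lambda>k. ereal (w k))"
proof (rule ccontr)
  define g where "g = sqrt (A\<^sup>2 + L\<^sup>2)"
  assume "\<not> ?thesis"
  then obtain r where r: "limsup (\<lambda>k. ereal (w k)) < ereal r" "r < g"
    using ereal_dense2[of "limsup (\<lambda>k. ereal (w k))" "ereal g"] by (auto simp: g_def not_le)
  define q where "q = (g + r) / 2"
  have q: "q < g" using r by (simp add: q_def)
  have "\<forall>\<^sub>F k in sequentially. w k < r"
    using Limsup_lessD[OF r(1)] by simp
  moreover have "\<forall>\<^sub>F k in sequentially. w k \<ge> sqrt (A\<^sup>2 + (u k)\<^sup>2) - (g - r) / 2"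
    using r by (intro ev) simp
  ultimately have *: "\<forall>\<^sub>F k in sequentially. sqrt (A\<^sup>2 + (u k)\<^sup>2) \<le> q"
    by eventually_elim (simp add: q_def field_simps)
  then obtain k where "sqrt (A\<^sup>2 + (u k)\<^sup>2) \<le> q"
    using eventually_happens by fastforce
  then have q0: "0 \<le> q" by (meson order_trans real_sqrt_ge_zero sum_power2_ge_zero)
  have "\<forall>\<^sub>F k in sequentially. ereal (u k) \<le> ereal (sqrt (q\<^sup>2 - A\<^sup>2))"
    using *
  proof eventually_elim
    case (elim k)
    then have "A\<^sup>2 + (u k)\<^sup>2 \<le> q\<^sup>2" by (rule sqrt_le_D)
    then show ?case by (simp add: real_le_rsqrt)
  qed
  then have "limsup (\<lambda>k. ereal (u k)) \<le> ereal (sqrt (q\<^sup>2 - A\<^sup>2))"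
    by (rule Limsup_bounded)
  then have "L \<le> sqrt (q\<^sup>2 - A\<^sup>2)"
    by (simp add: L)
  moreover have "A\<^sup>2 \<le> q\<^sup>2"
    using sqrt_le_D[OF \<open>sqrt (A\<^sup>2 + (u k)\<^sup>2) \<le> q\<close>] zero_le_power2[of "u k"] by linarith
  ultimately have "L\<^sup>2 \<le> q\<^sup>2 - A\<^sup>2"
    using power_mono[OF _ L(2), of "sqrt (q\<^sup>2 - A\<^sup>2)" 2] by simp
  then have "g \<le> q"
    unfolding g_def using q0 by (intro real_le_lsqrt) auto
  with q show False by simp
qed

theorem theorem5p3:
  fixes c :: real and J :: "(nat \<Rightarrow> real) \<Rightarrow> 'a::banach"
  assumes "0 < c" and "c < 1" and "X_space c J"
  shows "(\<forall>(f :: 'a \<Rightarrow>\<^sub>L real) (h :: nat \<Rightarrow> 'a \<Rightarrow>\<^sub>L real). weakly_null h \<longrightarrow>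
           (\<exists>L :: real. limsup (\<lambda>k. ereal (norm (h k))) = ereal L \<and>
              limsup (\<lambda>k. ereal (norm (f + h k))) \<ge> ereal (sqrt ((norm f)\<^sup>2 + L\<^sup>2))))
         \<and> opial_property TYPE('a \<Rightarrow>\<^sub>L real)"
proof -
  have main: "\<exists>L. limsup (\<lambda>k. ereal (norm (h k))) = ereal L \<and> 0 \<le> L \<and>
      limsup (\<lambda>k. ereal (norm (f + h k))) \<ge> ereal (sqrt ((norm f)\<^sup>2 + L\<^sup>2))"
    if "weakly_null h" for f :: "'a \<Rightarrow>\<^sub>L real" and h
  proof -
    have null: "(\<lambda>k. h k v) \<longlonglongrightarrow> 0" for v
      using that by (rule weakly_null_pointwise)
    then have "Bseq h"
      by (intro uniform_boundedness) (auto intro: convergent_imp_Bseq convergentI)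
    then obtain L where L: "limsup (\<lambda>k. ereal (norm (h k))) = ereal L" "0 \<le> L"
      by (rule limsup_norm_real)
    then show ?thesis
      using limsup_sqrt_le[OF eventually_norm_add_ge[OF assms null] L] by blast
  qed
  have "opial_property TYPE('a \<Rightarrow>\<^sub>L real)"
    unfolding opial_property_def
  proof (intro allI impI)
    fix f :: "'a \<Rightarrow>\<^sub>L real" and h :: "nat \<Rightarrow> 'a \<Rightarrow>\<^sub>L real"
    assume "f \<noteq> 0" "weakly_null h"
    then obtain L where L: "limsup (\<lambda>k. ereal (norm (h k))) = ereal L" "0 \<le> L"
        "limsup (\<lambda>k. ereal (norm (f + h k))) \<ge> ereal (sqrt ((norm f)\<^sup>2 + L\<^sup>2))"
      using main by blast
    have "L < sqrt ((norm f)\<^sup>2 + L\<^sup>2)"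
      using \<open>f \<noteq> 0\<close> by (intro real_less_rsqrt) simp
    then show "limsup (\<lambda>k. ereal (norm (h k))) < limsup (\<lambda>k. ereal (norm (f + h k)))"
      using L by (metis less_ereal.simps(1) order_less_le_trans)
  qed
  then show ?thesis using main by blast
qed

end
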